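(* Let $M>0$ and let $f=h+\overline{g}\in\mathcal{P}^0_{\mathcal{H}}(M)$ be given by $f(z)=z+\sum_{n=2}^{\infty}a_nz^n+\overline{\sum_{n=2}^{\infty}b_nz^n}$. Then for $N\ge 2$ we have $$|f(z)|+\sum_{n=N}^{\infty}(|a_n|+|b_n|)|z|^n\le d\left(f(0),\partial f(\mathbb{D})\right)$$ for $|z|=r\le r_N(M)$, where $r_N(M)$ is the smallest root in $(0,1)$ of the equation $$r-1+2M\left(2r-1+2(1-r)\ln(1-r)-\sum_{n=2}^{N-1}\frac{r^n}{n(n-1)}+\ln 4\right)=0 .$$ The radius $r_N(M)$ is the best possible.
   Context: $\mathbb{D}=\{z\in\mathbb{C}:|z|<1\}$. $\mathcal{H}_0$ is the class of complex-valued harmonic mappings $f=h+\overline{g}$ in $\mathbb{D}$ with $h,g$ analytic in $\mathbb{D}$, $h(0)=0$, $h'(0)=1$, $g(0)=0$, $g'(0)=0$. For $M>0$, $$\mathcal{P}^0_{\mathcal{H}}(M)=\{f=h+\overline{g}\in\mathcal{H}_0:\ \operatorname{Re}(zh''(z))>-M+|zg''(z)|\ \text{for all } z\in\mathbb{D}\}.$$ $N$ is an integer. $d(f(0),\partial f(\mathbb{D}))$ denotes the Euclidean distance between $f(0)$ and the boundary of $f(\mathbb{D})$, given by $d(f(0),\partial f(\mathbb{D}))=\liminf_{|z|\to1}|f(z)-f(0)|$. Empty sums are $0$. "Best possible" means that the radius cannot be replaced by a larger one for the whole class.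
   Formalization: The root r_N(M) is asserted to exist only for M < 1/(2(ln 4 − 1)); for larger M the left side is increasing and nonnegative at r = 0, so the equation has no root in (0,1). The inequality and sharpness are stated for every M > 0 for which the root exists. *)

theory Defs
  imports "HOL-Complex_Analysis.Complex_Analysis"
begin

definition H0_decomposition ::
    "(complex \<Rightarrow> complex) \<Rightarrow> (complex \<Rightarrow> complex) \<Rightarrow> (complex \<Rightarrow> complex) \<Rightarrow> bool" where
  "H0_decomposition f h g \<longleftrightarrow>
     h holomorphic_on ball 0 1 \<and> g holomorphic_on ball 0 1 \<and>
     h 0 = 0 \<and> deriv h 0 = 1 \<and> g 0 = 0 \<and> deriv g 0 = 0 \<and>
     (\<forall>z\<in>ball 0 1. f z = h z + cnj (g z))"

definition class_H0 :: "(complex \<Rightarrow> complex) set" where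
  "class_H0 = {f. \<exists>h g. H0_decomposition f h g}"

text \<open>The decomposition of a member of \<^const>\<open>class_H0\<close> is unique on the disc, so the
  existential quantifier below makes no choice. Only values on the open unit disc matter.\<close>

definition class_P0H :: "real \<Rightarrow> (complex \<Rightarrow> complex) set" where
  "class_P0H M = {f \<in> class_H0. \<exists>h g. H0_decomposition f h g \<and>
     (\<forall>z\<in>ball 0 1. Re (z * deriv (deriv h) z) > - M + cmod (z * deriv (deriv g) z))}"

text \<open>Only the values of \<open>a\<close> and \<open>b\<close> at indices \<open>n \<ge> 2\<close> are used.\<close>

definition has_harmonic_expansion ::
    "(complex \<Rightarrow> complex) \<Rightarrow> (nat \<Rightarrow> complex) \<Rightarrow> (nat \<Rightarrow> complex) \<Rightarrow> bool" where
  "has_harmonic_expansion f a b \<longleftrightarrow> (\<forall>z\<in>ball 0 1.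
     summable (\<lambda>n. a (n + 2) * z ^ (n + 2)) \<and>
     summable (\<lambda>n. b (n + 2) * z ^ (n + 2)) \<and>
     f z = z + (\<Sum>n. a (n + 2) * z ^ (n + 2)) + cnj (\<Sum>n. b (n + 2) * z ^ (n + 2)))"

text \<open>The quantity written \<open>d(f(0), \<partial>f(\<D>))\<close>, given by the lower limit of
  \<open>|f(z) - f(0)|\<close> as \<open>|z|\<close> tends to 1 inside the disc. For non-univalent \<open>f\<close> this can be
  smaller than the distance from \<open>f(0)\<close> to the frontier of the image.\<close>

definition boundary_dist :: "(complex \<Rightarrow> complex) \<Rightarrow> ereal" where
  "boundary_dist f =
     Liminf (filtercomap cmod (at_left 1)) (\<lambda>z. ereal (cmod (f z - f 0)))"

definition bohr_rogosinski_ineq ::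
    "nat \<Rightarrow> (complex \<Rightarrow> complex) \<Rightarrow> (nat \<Rightarrow> complex) \<Rightarrow> (nat \<Rightarrow> complex) \<Rightarrow> complex \<Rightarrow> bool" where
  "bohr_rogosinski_ineq N f a b z \<longleftrightarrow>
     ereal (cmod (f z) + (\<Sum>\<^sub>\<infinity>n\<in>{N..}. (cmod (a n) + cmod (b n)) * cmod z ^ n))
       \<le> boundary_dist f"

definition radius_fun :: "real \<Rightarrow> nat \<Rightarrow> real \<Rightarrow> real" where
  "radius_fun M N r =
     r - 1 + 2 * M * (2 * r - 1 + 2 * (1 - r) * ln (1 - r)
       - (\<Sum>n = 2..N - 1. r ^ n / (real n * (real n - 1))) + ln 4)"

definition is_smallest_root :: "real \<Rightarrow> nat \<Rightarrow> real \<Rightarrow> bool" where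
  "is_smallest_root M N \<rho> \<longleftrightarrow>
     0 < \<rho> \<and> \<rho> < 1 \<and> radius_fun M N \<rho> = 0 \<and>
     (\<forall>r. 0 < r \<and> r < 1 \<and> radius_fun M N r = 0 \<longrightarrow> \<rho> \<le> r)"

end

theory Submission
  imports Defs
begin

text \<open>
  For \<open>|\<epsilon>| \<le> 1\<close> the holomorphic function \<open>F = h + \<epsilon> g\<close> satisfies \<open>Re (z F'') > -M\<close>, so
  \<open>1 + z F'' / M\<close> has positive real part. Caratheodory's coefficient bound for a suitable \<open>\<epsilon>\<close> gives
  \<open>|a\<^sub>n| + |b\<^sub>n| \<le> 2 M / (n (n - 1))\<close>. Harnack's inequality yields a lower bound for \<open>Re (F z / z)\<close>,
  hence for \<open>|h| - |g| \<le> |f|\<close>, which tends to \<open>1 - 2 M (ln 4 - 1)\<close> as \<open>|z| \<rightarrow> 1\<close>; no univalence is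
  needed. Summing the coefficient bounds turns the claim into \<open>radius_fun M N |z| \<le> 0\<close>, and
  \<open>radius_fun M N\<close> is strictly increasing. All estimates are attained, along opposite radii, by
  \<open>z + 2 M (\<Sum>n\<ge>2. z\<^sup>n / (n (n - 1))) = z + 2 M (z + (1 - z) Ln (1 - z))\<close>.
\<close>

section \<open>Holomorphic functions\<close>

text \<open>Cauchy's formula at 0, with \<open>2 * pi * \<i>\<close> and one power cancelled against
  the velocity of \<open>circlepath\<close>. The case \<open>n = 0\<close> is the mean value
  property.\<close>

lemma has_integral_circle_mean:
  assumes "q holomorphic_on ball 0 R" "0 < r" "r < R"
  shows "((\<lambda>t. q (circlepath 0 r t) / circlepath 0 r t ^ n) has_integral (deriv ^^ n) q 0 / fact n) {0..1}"
proof -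
  have "((\<lambda>u. q u / (u - 0) ^ Suc n) has_contour_integral (2 * pi * \<i>) / fact n * (deriv ^^ n) q 0)
      (circlepath 0 r)"
    using assms
    by (intro Cauchy_has_contour_integral_higher_derivative_circlepath)
       (auto intro!: holomorphic_on_imp_continuous_on intro: holomorphic_on_subset)
  then have "((\<lambda>t. q (circlepath 0 r t) / circlepath 0 r t ^ Suc n *
      (2 * pi * \<i> * r * exp (2 * pi * \<i> * t))) has_integral (2 * pi * \<i>) / fact n * (deriv ^^ n) q 0) {0..1}"
    by (simp add: has_contour_integral vector_derivative_circlepath)
  moreover have "q (circlepath 0 r t) / circlepath 0 r t ^ Suc n * (2 * pi * \<i> * r * exp (2 * pi * \<i> * t))
      = (2 * pi * \<i>) * (q (circlepath 0 r t) / circlepath 0 r t ^ n)" for t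
    using \<open>0 < r\<close> by (simp add: circlepath field_simps)
  ultimately have "((\<lambda>t. (2 * pi * \<i>) * (q (circlepath 0 r t) / circlepath 0 r t ^ n)) has_integral
      (2 * pi * \<i>) / fact n * (deriv ^^ n) q 0) {0..1}"
    by simp
  from has_integral_mult_right[OF this, of "1 / (2 * pi * \<i>)"] show ?thesis
    by (simp add: field_simps)
qed

text \<open>The \<open>n\<close>-th Fourier coefficient of \<open>cnj p\<close> on a circle vanishes for \<open>n > 0\<close>, so \<open>p\<close> may be
  replaced by \<open>2 Re p\<close> in Cauchy's formula.\<close>

lemma Caratheodory_coeff_bound:
  assumes holp: "p holomorphic_on ball 0 1" and pos: "\<And>z. z \<in> ball 0 1 \<Longrightarrow> 0 \<le> Re (p z)"
    and "0 < n"
  shows "cmod ((deriv ^^ n) p 0 / fact n) \<le> 2 * Re (p 0)"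
proof -
  let ?D = "(deriv ^^ n) p 0 / fact n"
  have bound: "cmod ?D * r ^ n \<le> 2 * Re (p 0)" if r: "0 < r" "r < 1" for r
  proof -
    let ?c = "circlepath 0 r"
    have norm_c: "cmod (?c t) = r" for t
      using r by (simp add: circlepath norm_mult)
    have "((\<lambda>t. p (?c t) * ?c t ^ n) has_integral p 0 * 0 ^ n) {0..1}"
      using has_integral_circle_mean[of "\<lambda>u. p u * u ^ n" 1 r 0] holp r
      by (simp add: holomorphic_intros)
    then have "((\<lambda>t. p (?c t) * ?c t ^ n) has_integral 0) {0..1}"
      using \<open>0 < n\<close> by (simp add: power_0_left)
    then have "((\<lambda>t. cnj (p (?c t) * ?c t ^ n)) has_integral 0) {0..1}"
      using has_integral_cnj[of "\<lambda>t. p (?c t) * ?c t ^ n" 0] by (simp add: o_def)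
    \<comment> \<open>On the circle \<open>cnj (?c t) * ?c t\<close> is constant, so this factor
      produces the weight \<open>1 / ?c t ^ n\<close> of Cauchy's formula.\<close>
    from has_integral_mult_right[OF this, of "1 / of_real (r ^ (2 * n))"]
    have "((\<lambda>t. cnj (p (?c t)) * (cnj (?c t) ^ n / of_real (r ^ (2 * n)))) has_integral 0) {0..1}"
      by simp
    moreover have "cnj (?c t) ^ n / of_real (r ^ (2 * n)) = 1 / ?c t ^ n" for t
    proof -
      have "cnj (?c t) * ?c t = of_real (r ^ 2)"
        using complex_norm_square[of "?c t"] norm_c by (simp add: mult.commute)
      then have "cnj (?c t) ^ n * ?c t ^ n = of_real (r ^ (2 * n))"
        by (metis of_real_power power_mult power_mult_distrib)
      moreover have "?c t \<noteq> 0"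
        using norm_c[of t] r by auto
      ultimately show ?thesis
        using r by (simp add: field_simps)
    qed
    ultimately have "((\<lambda>t. cnj (p (?c t)) / ?c t ^ n) has_integral 0) {0..1}"
      by (simp only: times_divide_eq_right mult_1_right)
    from has_integral_add[OF has_integral_circle_mean[OF holp r, of n] this]
    have I: "((\<lambda>t. of_real (2 * Re (p (?c t))) / ?c t ^ n) has_integral ?D) {0..1}"
      by (simp add: add_divide_distrib [symmetric] complex_add_cnj)
    have "((\<lambda>t. Re (p (?c t))) has_integral Re (p 0)) {0..1}"
      using has_integral_Re[OF has_integral_circle_mean[OF holp r, of 0]] by simp
    from has_integral_mult_right[OF this, of "2 / r ^ n"]
    have J: "((\<lambda>t. 2 / r ^ n * Re (p (?c t))) has_integral 2 / r ^ n * Re (p 0)) {0..1}" .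
    have "cmod (of_real (2 * Re (p (?c t))) / ?c t ^ n) \<le> 2 / r ^ n * Re (p (?c t))" for t
      using pos[of "?c t"] norm_c[of t] r by (simp add: norm_divide norm_mult norm_power)
    then have "norm (integral {0..1} (\<lambda>t. of_real (2 * Re (p (?c t))) / ?c t ^ n))
        \<le> integral {0..1} (\<lambda>t. 2 / r ^ n * Re (p (?c t)))"
      using I J by (intro integral_norm_bound_integral) blast+
    then have "cmod ?D \<le> 2 / r ^ n * Re (p 0)"
      by (simp only: integral_unique[OF I] integral_unique[OF J])
    then show ?thesis
      using r by (simp add: field_simps)
  qed
  have "((\<lambda>r. cmod ?D * r ^ n) \<longlongrightarrow> cmod ?D * 1 ^ n) (at_left 1)"
    by (intro tendsto_intros)
  moreover have "eventually (\<lambda>r. cmod ?D * r ^ n \<le> 2 * Re (p 0)) (at_left 1)"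
    using eventually_at_left_real[of 0 1] by (rule eventually_mono) (use bound in auto)
  ultimately show ?thesis
    using tendsto_upperbound[of "\<lambda>r. cmod ?D * r ^ n" "cmod ?D * 1 ^ n" "at_left 1"] by simp
qed

text \<open>The Cayley transform \<open>(p - 1) / (p + 1)\<close> maps the disc into itself and
  sends 0 to 0. The Schwarz lemma bounds it, and the bound is solved for
  \<open>Re (p z)\<close>.\<close>

lemma Harnack_lower:
  assumes holp: "p holomorphic_on ball 0 1" and pos: "\<And>z. z \<in> ball 0 1 \<Longrightarrow> 0 < Re (p z)"
    and p0: "p 0 = 1" and z: "cmod z < 1"
  shows "(1 - cmod z) / (1 + cmod z) \<le> Re (p z)"
proof -
  define W where "W z = (p z - 1) / (p z + 1)" for z
  have nz: "p z + 1 \<noteq> 0" if "cmod z < 1" for z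
    using pos[of z] that by (auto simp: complex_eq_iff)
  have lt: "cmod (p z - 1) < cmod (p z + 1)" if "cmod z < 1" for z
  proof -
    have "(cmod (p z - 1))\<^sup>2 < (cmod (p z + 1))\<^sup>2"
      using pos[of z] that unfolding cmod_power2 by (simp add: power2_eq_square algebra_simps)
    then show ?thesis
      by (simp add: power_less_imp_less_base)
  qed
  have "cmod (W z) \<le> cmod z"
  proof (rule Schwarz_Lemma(1))
    show "W holomorphic_on ball 0 1"
      unfolding W_def using holp nz by (intro holomorphic_intros) auto
    show "W 0 = 0"
      by (simp add: W_def p0)
    show "cmod (W z) < 1" if "cmod z < 1" for z
      using lt[OF that] nz[OF that] by (simp add: W_def norm_divide)
  qed (use z in auto)
  then have "cmod (p z - 1) \<le> cmod z * cmod (p z + 1)"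
    using nz[OF z] by (simp add: W_def norm_divide field_simps)
  then have "(cmod (p z - 1))\<^sup>2 \<le> (cmod z)\<^sup>2 * (cmod (p z + 1))\<^sup>2"
    by (metis norm_ge_zero power_mono power_mult_distrib)
  then have "(Re (p z) - 1)\<^sup>2 + (1 - (cmod z)\<^sup>2) * (Im (p z))\<^sup>2 \<le> (cmod z)\<^sup>2 * (Re (p z) + 1)\<^sup>2"
    by (simp add: cmod_power2 algebra_simps)
  moreover have "0 \<le> (1 - (cmod z)\<^sup>2) * (Im (p z))\<^sup>2"
    using z by (simp add: power_le_one)
  ultimately have "(1 - Re (p z))\<^sup>2 \<le> (cmod z * (Re (p z) + 1))\<^sup>2"
    by (simp add: power_mult_distrib power2_commute[of 1])
  then have "1 - Re (p z) \<le> cmod z * (Re (p z) + 1)"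
    by (rule power2_le_imp_le) (use pos[of z] z in simp)
  moreover have "0 < 1 + cmod z"
    by (simp add: add_pos_nonneg)
  ultimately show ?thesis
    by (simp add: pos_divide_le_eq algebra_simps)
qed

text \<open>The factor \<open>c\<close> lets one rule serve both \<open>F\<close> (with
  \<open>c = 1 / z\<close>) and \<open>deriv F\<close> (with \<open>c = 1\<close>).\<close>

lemma Re_has_real_derivative_on_ray:
  assumes "(F has_field_derivative D) (at (of_real t * z))"
  shows "((\<lambda>t. Re (c * F (of_real t * z))) has_real_derivative Re (c * (D * z))) (at t)"
proof -
  have "((\<lambda>s. c * F (s * z)) has_field_derivative c * (D * z)) (at (of_real t))"
    by (intro DERIV_cmult DERIV_chain'[where g = F and f = "\<lambda>s. s * z", THEN DERIV_cong])
       (use assms in \<open>auto intro!: derivative_eq_intros\<close>)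
  then show ?thesis
    by (intro has_field_derivative_Re has_vector_derivative_real_field)
qed

text \<open>Harnack bounds the second derivative of \<open>t \<mapsto> Re (F (t z) / z)\<close> from below by
  \<open>- 2 M r / (1 + t r)\<close>; integrating twice along the ray gives the estimate.\<close>

lemma Re_growth_lower:
  assumes holF: "F holomorphic_on ball 0 1" and F0: "F 0 = 0" "deriv F 0 = 1" and "0 < M"
    and pos: "\<And>z. z \<in> ball 0 1 \<Longrightarrow> - M < Re (z * deriv (deriv F) z)"
    and z: "cmod z < 1" "z \<noteq> 0"
  shows "cmod z - 2 * M * ((1 + cmod z) * ln (1 + cmod z) - cmod z) \<le> Re (F z / z) * cmod z"
proof -
  define r where "r = cmod z"
  have r: "0 < r" "r < 1"
    using z by (auto simp: r_def)
  have tr: "0 < 1 + t * r" if "0 \<le> t" for t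
    using that r by (simp add: add_pos_nonneg)
  have in_ball: "of_real t * z \<in> ball 0 1" if "0 \<le> t" "t \<le> 1" for t :: real
    using that z by (simp add: norm_mult) (smt (verit) mult_left_le_one_le norm_ge_zero)
  have dF: "(F has_field_derivative deriv F w) (at w)" 
    "(deriv F has_field_derivative deriv (deriv F) w) (at w)" if "w \<in> ball 0 1" for w
    using that holF by (auto intro!: holomorphic_derivI holomorphic_deriv)
  have lower: "- 2 * M * r / (1 + t * r) \<le> Re (deriv (deriv F) (of_real t * z) * z)"
    if t: "0 < t" "t < 1" for t
  proof -
    define w where "w = of_real t * z"
    have w: "cmod w = t * r" "w \<in> ball 0 1"
      using in_ball[of t] t by (auto simp: w_def r_def norm_mult)
    have "(1 - cmod w) / (1 + cmod w) \<le> Re (1 + w * deriv (deriv F) w / of_real M)"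
    proof (rule Harnack_lower)
      show "(\<lambda>w. 1 + w * deriv (deriv F) w / of_real M) holomorphic_on ball 0 1"
        using holF \<open>0 < M\<close> by (auto intro!: holomorphic_intros)
      show "0 < Re (1 + w * deriv (deriv F) w / of_real M)" if "w \<in> ball 0 1" for w
        using pos[OF that] \<open>0 < M\<close> by (simp add: Re_divide_of_real field_simps del: times_complex.sel)
    qed (use w in auto)
    then have "M * ((1 - t * r) / (1 + t * r) - 1) \<le> Re (w * deriv (deriv F) w)"
      using w \<open>0 < M\<close> by (simp add: Re_divide_of_real field_simps del: times_complex.sel)
    also have "Re (w * deriv (deriv F) w) = t * Re (deriv (deriv F) w * z)"
      by (simp add: w_def algebra_simps)
    also have "M * ((1 - t * r) / (1 + t * r) - 1) = t * (- 2 * M * r / (1 + t * r))"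
      using tr[of t] t by (simp add: divide_simps)
    finally have "t * (- 2 * M * r / (1 + t * r)) \<le> t * Re (deriv (deriv F) (of_real t * z) * z)"
      by (simp only: w_def)
    then show ?thesis
      using t by (simp only: mult_le_cancel_left_pos)
  qed
  define d where "d t = Re (1 * (deriv (deriv F) (of_real t * z) * z)) + 2 * M * r / (1 + t * r)" for t
  have d_nonneg: "0 \<le> d t" if "0 < t" "t < 1" for t
    using lower[OF that] by (simp add: d_def)
  define \<phi>1 where "\<phi>1 t = Re (1 * deriv F (of_real t * z)) - 1 + 2 * M * ln (1 + t * r)" for t
  \<comment> \<open>The last summand is the antiderivative of \<open>2 * M * ln (1 + t * r)\<close>
    that vanishes at 0.\<close>
  define \<phi>0 where "\<phi>0 t = Re (1 / z * F (of_real t * z)) - t + 2 * M / r * ((1 + t * r) * ln (1 + t * r) - t * r)" for t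
  have d1: "(\<phi>1 has_real_derivative d t) (at t)"
    if "0 \<le> t" "t \<le> 1" for t
    unfolding \<phi>1_def d_def
    by (rule Re_has_real_derivative_on_ray[OF dF(2)[OF in_ball[OF that]]] derivative_eq_intros refl tr[OF that(1)])+ simp
  have d0: "(\<phi>0 has_real_derivative \<phi>1 t) (at t)"
    if "0 \<le> t" "t \<le> 1" for t
    unfolding \<phi>0_def \<phi>1_def
    by (rule Re_has_real_derivative_on_ray[OF dF(1)[OF in_ball[OF that]]] derivative_eq_intros refl tr[OF that(1)])+
      (use r z tr[OF that(1)] in \<open>simp add: divide_simps; simp add: algebra_simps\<close>)
  have \<phi>1_nonneg: "0 \<le> \<phi>1 t" if "0 \<le> t" "t \<le> 1" for t
  proof -
    have "\<phi>1 0 \<le> \<phi>1 t"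
    \<comment> \<open>The sign of \<open>d\<close> is known only on the open interval, since
      \<open>lower\<close> cancels a factor \<open>t > 0\<close>.\<close>
    proof (rule DERIV_nonneg_imp_increasing_open[OF that(1)])
      show "\<exists>y. (\<phi>1 has_real_derivative y) (at x) \<and> 0 \<le> y" if "0 < x" "x < t" for x
        using that \<open>t \<le> 1\<close> by (intro exI[of _ "d x"] conjI d1 d_nonneg) auto
      show "continuous_on {0..t} \<phi>1"
        using d1 that by (intro continuous_at_imp_continuous_on ballI DERIV_isCont[OF d1]) auto
    qed
    then show ?thesis
      by (simp add: \<phi>1_def F0)
  qed
  have "\<phi>0 0 \<le> \<phi>0 1"
  proof (rule DERIV_nonneg_imp_nondecreasing[where f = \<phi>0])
    show "\<exists>y. (\<phi>0 has_real_derivative y) (at x) \<and> 0 \<le> y" if "0 \<le> x" "x \<le> 1" for x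
      using d0[OF that] \<phi>1_nonneg[OF that] by blast
  qed simp
  moreover have "\<phi>0 0 = 0"
    by (simp add: \<phi>0_def F0)
  moreover have "\<phi>0 1 = Re (F z / z) - 1 + 2 * M / r * ((1 + r) * ln (1 + r) - r)"
    unfolding \<phi>0_def by simp
  ultimately have "1 - 2 * M / r * ((1 + r) * ln (1 + r) - r) \<le> Re (F z / z)"
    by linarith
  then have "(1 - 2 * M / r * ((1 + r) * ln (1 + r) - r)) * r \<le> Re (F z / z) * r"
    using r by (intro mult_right_mono) auto
  moreover have "(1 - 2 * M / r * ((1 + r) * ln (1 + r) - r)) * r = r - 2 * M * ((1 + r) * ln (1 + r) - r)"
    using r by (simp add: left_diff_distrib)
  ultimately show ?thesis
    by (simp only: r_def)
qed

text \<open>With \<open>n = Suc m\<close>, the coefficient of index \<open>m\<close> of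
  \<open>1 + z F'' / M\<close> is \<open>n (n - 1) / M * c n\<close>. This function is 1 at 0, so
  Caratheodory's bound is 2.\<close>

lemma coeff_bound:
  assumes sumsF: "\<And>z. z \<in> ball 0 1 \<Longrightarrow> (\<lambda>n. c n * z ^ n) sums F z" and "0 < M"
    and pos: "\<And>z. z \<in> ball 0 1 \<Longrightarrow> - M < Re (z * deriv (deriv F) z)"
    and n: "2 \<le> n"
  shows "cmod (c n) \<le> 2 * M / (real n * (real n - 1))"
proof -
  obtain m where m: "n = Suc m" "0 < m"
    using n by (cases n) auto
  define p where "p w = 1 + of_real (1 / M) * (w * deriv (deriv F) w)" for w
  have "F holomorphic_on ball 0 1"
    using sumsF by (intro power_series_holomorphic[where a = c]) auto
  then have holp: "p holomorphic_on ball 0 1"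
    unfolding p_def by (auto intro!: holomorphic_intros)
  have "F has_fps_expansion Abs_fps c"
    using sumsF by (intro has_fps_expansionI eventually_nhds_in_open[of "ball 0 1", THEN eventually_mono]) auto
  then have "p has_fps_expansion 1 + fps_const (of_real (1 / M)) * (fps_X * fps_deriv (fps_deriv (Abs_fps c)))"
    unfolding p_def by (intro fps_expansion_intros)
  from fps_nth_fps_expansion[OF this, of m]
  have "(deriv ^^ m) p 0 / fact m = of_real (real n * (real n - 1) / M) * c n"
    using m by (cases m) (simp_all add: field_simps)
  moreover have "cmod ((deriv ^^ m) p 0 / fact m) \<le> 2 * Re (p 0)"
  proof (rule Caratheodory_coeff_bound[OF holp])
    show "0 \<le> Re (p w)" if "w \<in> ball 0 1" for w
      using pos[OF that] \<open>0 < M\<close> by (simp add: p_def field_simps del: times_complex.sel)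
  qed (use m in auto)
  ultimately have "cmod (of_real (real n * (real n - 1) / M) * c n) \<le> 2"
    by (simp add: p_def)
  then have "real n * (real n - 1) / M * cmod (c n) \<le> 2"
    using n \<open>0 < M\<close> by (simp only: norm_mult norm_of_real) simp
  then show ?thesis
    using n \<open>0 < M\<close> by (simp add: field_simps)
qed

text \<open>The derivative of \<open>u\<close> is both complex linear and conjugate linear;
  comparing at 1 and \<open>\<i>\<close> makes it 0. This gives uniqueness of the splitting
  \<open>h + cnj g\<close>.\<close>

lemma holomorphic_eq_cnj_imp_const:
  assumes "u holomorphic_on S" "v holomorphic_on S" "open S" "convex S"
    and eq: "\<And>z. z \<in> S \<Longrightarrow> u z = cnj (v z)"
    and "w \<in> S" "z \<in> S"
  shows "u z = u w"
proof -
  have "(u has_field_derivative 0) (at z within S)" if "z \<in> S" for z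
  proof -
    define d e where "d = deriv u z" and "e = deriv v z"
    have d: "(u has_field_derivative d) (at z)" and e: "(v has_field_derivative e) (at z)"
      unfolding d_def e_def using assms(1-3) that by (auto intro: holomorphic_derivI)
    have "((\<lambda>z. cnj (v z)) has_derivative (\<lambda>x. cnj (e * x))) (at z)"
      using e by (intro has_derivative_cnj) (simp add: has_field_derivative_def)
    then have "(u has_derivative (\<lambda>x. cnj (e * x))) (at z)"
      by (rule has_derivative_transform_within_open[OF _ \<open>open S\<close> that]) (simp add: eq)
    moreover have "(u has_derivative (\<lambda>x. d * x)) (at z)"
      using d by (simp add: has_field_derivative_def)
    ultimately have "(\<lambda>x. cnj (e * x)) = (\<lambda>x. d * x)"
      by (rule has_derivative_unique)
    from fun_cong[OF this, of 1] fun_cong[OF this, of \<i>] have "d = 0"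
      by (simp add: complex_eq_iff)
    with d show ?thesis
      by (simp add: DERIV_subset[of _ _ _ UNIV])
  qed
  then have "\<exists>c. \<forall>z\<in>S. u z = c"
    using \<open>convex S\<close> by (intro has_field_derivative_zero_constant) auto
  then show ?thesis
    using assms(6,7) by metis
qed

lemma exists_rotation_to_norm:
  obtains \<epsilon> :: complex where "cmod \<epsilon> = 1" "\<epsilon> * y = of_real (cmod y)"
proof (cases "y = 0")
  case False
  show ?thesis
  proof (rule that)
    show "cmod (cnj (sgn y)) = 1"
      using False by (simp add: norm_sgn)
    show "cnj (sgn y) * y = of_real (cmod y)"
      using complex_norm_square[of y] False
      by (simp add: sgn_div_norm scaleR_conv_of_real field_simps power2_eq_square)
  qed
qed (use that[of 1] in simp)

text \<open>Both numbers are rotated onto the nonnegative real axis; the quotient of the rotations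
  aligns \<open>y\<close> with \<open>x\<close>.\<close>

lemma exists_aligning_rotation:
  obtains \<epsilon> :: complex where "cmod \<epsilon> = 1" "cmod (x + \<epsilon> * y) = cmod x + cmod y"
proof -
  obtain \<delta> \<epsilon> where \<delta>: "cmod \<delta> = 1" "\<delta> * x = of_real (cmod x)"
    and \<epsilon>: "cmod \<epsilon> = 1" "\<epsilon> * y = of_real (cmod y)"
    using exists_rotation_to_norm by metis
  show ?thesis
  proof (rule that)
    show "cmod (\<epsilon> / \<delta>) = 1"
      using \<delta> \<epsilon> by (simp add: norm_divide)
    have "cmod (x + \<epsilon> / \<delta> * y) = cmod (\<delta> * (x + \<epsilon> / \<delta> * y))"
      using \<delta> by (simp add: norm_mult)
    also have "\<delta> * (x + \<epsilon> / \<delta> * y) = of_real (cmod x + cmod y)"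
      using \<delta> \<epsilon> by (auto simp: algebra_simps)
    finally show "cmod (x + \<epsilon> / \<delta> * y) = cmod x + cmod y"
      by (simp only: norm_of_real) simp
  qed
qed

section \<open>The logarithmic series and the radius equation\<close>

text \<open>Partial fractions \<open>1 / (n - 1) - 1 / n\<close> split the series into two
  logarithmic ones.\<close>

lemma sums_log_complex:
  fixes z :: complex
  assumes "cmod z < 1"
  shows "(\<lambda>n. z ^ n / (of_nat n * (of_nat n - 1))) sums (z + (1 - z) * Ln (1 - z))"
proof -
  define L where "L = - Ln (1 - z)"
  have L: "(\<lambda>n. z ^ n / of_nat n) sums L"
    using sums_minus[OF Ln_series'[of "- z"]] assms by (simp add: L_def)
  define k where "k n = z ^ n / (of_nat n - 1)" for n
  have "(\<lambda>n. k (Suc n)) sums (z * L)"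
    using sums_mult[OF L, of z] by (simp add: k_def)
  then have "k sums (z * L - 1)"
    using sums_Suc[of k] by (simp add: k_def)
  \<comment> \<open>As \<open>x / 0 = 0\<close>, the partial fractions give \<open>-1\<close> at
    index 0 and \<open>-z\<close> at index 1, while the target term is 0 at both; this finite series
    corrects them.\<close>
  moreover have "(\<lambda>n. if n \<in> {0, 1} then (if n = 0 then 1 else z) else 0) sums
      (\<Sum>n\<in>{0, 1::nat}. if n = 0 then 1 else z)"
    by (rule sums_If_finite_set) simp
  ultimately have "(\<lambda>n. k n - z ^ n / of_nat n + (if n \<in> {0, 1} then (if n = 0 then 1 else z) else 0)) sums
      (z * L - 1 - L + (\<Sum>n\<in>{0, 1::nat}. if n = 0 then 1 else z))"
    by (intro sums_add sums_diff L)
  moreover have "k n - z ^ n / of_nat n + (if n \<in> {0, 1} then (if n = 0 then 1 else z) else 0)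
      = z ^ n / (of_nat n * (of_nat n - 1))" for n
  proof (cases "n \<in> {0, 1}")
    case False
    then have "(of_nat n :: complex) \<noteq> 0" "(of_nat n :: complex) - 1 \<noteq> 0"
      by auto
    then show ?thesis
      using False by (simp add: k_def field_simps)
  qed (auto simp: k_def)
  ultimately show ?thesis
    by (simp add: L_def algebra_simps)
qed

text \<open>For \<open>\<bar>r\<bar> < 1\<close> this is the sum of
  \<open>r ^ n / (n (n - 1))\<close> over \<open>n \<ge> 2\<close>, so that
  \<open>log_tail N\<close> is its tail from \<open>N\<close> on.\<close>

definition log_sum :: "real \<Rightarrow> real" where
  "log_sum r = r + (1 - r) * ln (1 - r)"

definition log_tail :: "nat \<Rightarrow> real \<Rightarrow> real" where
  "log_tail N r = log_sum r - (\<Sum>n = 2..N - 1. r ^ n / (real n * (real n - 1)))"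

text \<open>The terms at \<open>n = 0\<close> and \<open>n = 1\<close> vanish because \<open>x / 0 = 0\<close>.\<close>

lemma log_sum_sums:
  assumes "\<bar>r\<bar> < 1"
  shows "(\<lambda>n. r ^ n / (real n * (real n - 1))) sums log_sum r"
proof -
  have "(\<lambda>n. complex_of_real (r ^ n / (real n * (real n - 1)))) sums complex_of_real (log_sum r)"
    using sums_log_complex[of "of_real r"] assms Ln_of_real[of "1 - r"] by (simp add: log_sum_def)
  then show ?thesis
    by (simp only: sums_of_real_iff)
qed

lemma log_tail_has_sum:
  assumes "0 \<le> r" "r < 1" "2 \<le> N"
  shows "((\<lambda>n. r ^ n / (real n * (real n - 1))) has_sum log_tail N r) {N..}"
proof -
  let ?x = "\<lambda>n. r ^ n / (real n * (real n - 1))"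
  have nonneg: "0 \<le> ?x n" for n
    using assms by (cases n) auto
  have "(\<lambda>n. if n \<in> {..<N} then ?x n else 0) sums (\<Sum>n<N. ?x n)"
    by (rule sums_If_finite_set) simp
  moreover have "(\<Sum>n<N. ?x n) = (\<Sum>n = 2..N - 1. ?x n)"
  proof (rule sum.mono_neutral_right)
    show "\<forall>n\<in>{..<N} - {2..N - 1}. ?x n = 0"
    proof
      fix n assume "n \<in> {..<N} - {2..N - 1}"
      then have "n = 0 \<or> n = 1"
        by auto
      then show "?x n = 0"
        by auto
    qed
  qed (use assms in auto)
  ultimately have "(\<lambda>n. ?x n - (if n \<in> {..<N} then ?x n else 0)) sums log_tail N r"
    unfolding log_tail_def using assms by (intro sums_diff log_sum_sums) auto
  moreover have "?x n - (if n \<in> {..<N} then ?x n else 0) = (if n \<in> {N..} then ?x n else 0)" for n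
    by auto
  ultimately have "(\<lambda>n. if n \<in> {N..} then ?x n else 0) sums log_tail N r"
    by simp
  then have "((\<lambda>n. if n \<in> {N..} then ?x n else 0) has_sum log_tail N r) UNIV"
    using nonneg by (intro sums_nonneg_imp_has_sum) auto
  then show ?thesis
    by (rule iffD1[OF has_sum_cong_neutral, rotated 3]) auto
qed

lemma log_tail_mono:
  assumes "0 \<le> r" "r \<le> s" "s < 1" "2 \<le> N"
  shows "log_tail N r \<le> log_tail N s"
proof (rule has_sum_mono[OF log_tail_has_sum log_tail_has_sum])
  show "r ^ n / (real n * (real n - 1)) \<le> s ^ n / (real n * (real n - 1))" if "n \<in> {N..}" for n
    using assms that by (intro divide_right_mono power_mono) auto
qed (use assms in auto)

text \<open>For \<open>N = 2\<close> the subtracted sum is empty, so \<open>log_sum\<close> inherits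
  monotonicity and nonnegativity from \<open>log_tail\<close>.\<close>

lemma log_sum_eq_tail: "log_sum = log_tail 2"
  by (simp add: log_tail_def fun_eq_iff)

lemma log_tail_nonneg: "\<lbrakk>0 \<le> r; r < 1; 2 \<le> N\<rbrakk> \<Longrightarrow> 0 \<le> log_tail N r"
  by (rule has_sum_nonneg[OF log_tail_has_sum]) auto

text \<open>The summands match the estimates: \<open>log_sum\<close> from the bound on
  \<open>|f|\<close>, \<open>log_tail\<close> from the coefficient tail, \<open>ln 4 - 1\<close>
  from the boundary distance.\<close>

lemma radius_fun_eq:
  "radius_fun M N r = r - 1 + 2 * M * (log_sum r + log_tail N r + (ln 4 - 1))"
  by (simp add: radius_fun_def log_tail_def log_sum_def algebra_simps)

section \<open>Coefficient, growth and boundary estimates\<close>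

text \<open>The pair \<open>h\<close>, \<open>g\<close> quantified in \<open>class_P0H\<close> is
  fixed here. The sequences \<open>a\<close>, \<open>b\<close> are tied only to \<open>f\<close>;
  their link to \<open>h\<close>, \<open>g\<close> is \<open>sums_h_g\<close>.\<close>

locale P0H_member =
  fixes M :: real and f h g :: "complex \<Rightarrow> complex" and a b :: "nat \<Rightarrow> complex"
  assumes M_pos: "0 < M"
    and decomp: "H0_decomposition f h g"
    and second_deriv: "\<And>z. z \<in> ball 0 1 \<Longrightarrow> - M + cmod (z * deriv (deriv g) z) < Re (z * deriv (deriv h) z)"
    and expansion: "has_harmonic_expansion f a b"
begin

lemma holomorphic: "h holomorphic_on ball 0 1" "g holomorphic_on ball 0 1"
  and at_0: "h 0 = 0" "deriv h 0 = 1" "g 0 = 0" "deriv g 0 = 0"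
  and f_eq: "z \<in> ball 0 1 \<Longrightarrow> f z = h z + cnj (g z)"
  using decomp by (auto simp: H0_decomposition_def)

text \<open>\<open>a\<close> and \<open>b\<close> are arbitrary at indices 0 and 1; there the
  normalisation of \<open>h\<close> and \<open>g\<close> supplies the Taylor coefficients.\<close>

definition "ca n = (if n = 0 then 0 else if n = 1 then 1 else a n)"
definition "cb n = (if n = 0 \<or> n = 1 then 0 else b n)"

text \<open>The expansion gives a second splitting \<open>A + cnj B\<close> of \<open>f\<close>.
  Then \<open>h - A\<close> is the conjugate of the holomorphic \<open>B - g\<close>, hence
  constant, and it vanishes at 0.\<close>

lemma sums_h_g:
  assumes "z \<in> ball 0 1"
  shows "(\<lambda>n. ca n * z ^ n) sums h z" "(\<lambda>n. cb n * z ^ n) sums g z"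
proof -
  define A where "A z = z + (\<Sum>n. a (n + 2) * z ^ (n + 2))" for z
  define B where "B z = (\<Sum>n. b (n + 2) * z ^ (n + 2))" for z
  have sums: "(\<lambda>n. ca n * z ^ n) sums A z" "(\<lambda>n. cb n * z ^ n) sums B z" if "z \<in> ball 0 1" for z
  proof -
    have "summable (\<lambda>n. a (n + 2) * z ^ (n + 2))" "summable (\<lambda>n. b (n + 2) * z ^ (n + 2))"
      using expansion that by (auto simp: has_harmonic_expansion_def)
    then have "(\<lambda>n. ca (n + 2) * z ^ (n + 2)) sums (A z - (\<Sum>n<2. ca n * z ^ n))"
      "(\<lambda>n. cb (n + 2) * z ^ (n + 2)) sums (B z - (\<Sum>n<2. cb n * z ^ n))"
      by (auto simp: ca_def cb_def A_def B_def numeral_2_eq_2 dest!: summable_sums)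
    then show "(\<lambda>n. ca n * z ^ n) sums A z" "(\<lambda>n. cb n * z ^ n) sums B z"
      by (simp_all only: sums_iff_shift[of "\<lambda>n. ca n * z ^ n"] sums_iff_shift[of "\<lambda>n. cb n * z ^ n"]
          diff_add_cancel)
  qed
  have hol: "A holomorphic_on ball 0 1" "B holomorphic_on ball 0 1"
    using sums by (auto intro!: power_series_holomorphic)
  have fAB: "f z = A z + cnj (B z)" if "z \<in> ball 0 1" for z
    using expansion that by (simp add: has_harmonic_expansion_def A_def B_def)
  have "h z - A z = cnj (B z - g z)" if "z \<in> ball 0 1" for z
    using fAB[OF that] f_eq[OF that] by (simp add: algebra_simps)
  then have "h z - A z = h 0 - A 0"
    using assms holomorphic hol
    by (intro holomorphic_eq_cnj_imp_const[of "\<lambda>z. h z - A z" "ball 0 1" "\<lambda>z. B z - g z"])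
       (auto intro!: holomorphic_intros)
  then have "h z = A z"
    by (simp add: at_0 A_def)
  moreover from this have "g z = B z"
    using fAB[OF assms] f_eq[OF assms] by simp
  ultimately show "(\<lambda>n. ca n * z ^ n) sums h z" "(\<lambda>n. cb n * z ^ n) sums g z"
    using sums[OF assms] by simp_all
qed

text \<open>The term \<open>|z g''|\<close> in the class condition absorbs
  \<open>\<epsilon> z g''\<close>, so the estimates for a single holomorphic function apply to
  \<open>F\<close>.\<close>

lemma rotated:
  assumes "cmod \<epsilon> \<le> 1"
  defines "F \<equiv> \<lambda>z. h z + \<epsilon> * g z"
  shows "F holomorphic_on ball 0 1" "F 0 = 0" "deriv F 0 = 1"
    and "\<And>z. z \<in> ball 0 1 \<Longrightarrow> - M < Re (z * deriv (deriv F) z)"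
    and "\<And>z. z \<in> ball 0 1 \<Longrightarrow> (\<lambda>n. (ca n + \<epsilon> * cb n) * z ^ n) sums F z"
proof -
  have D: "(deriv ^^ n) F z = (deriv ^^ n) h z + \<epsilon> * (deriv ^^ n) g z" if "z \<in> ball 0 1" for n z
    unfolding F_def using that holomorphic
    by (subst higher_deriv_add[of _ "ball 0 1"])
       (auto intro!: holomorphic_intros higher_deriv_cmult[of _ "ball 0 1"])
  show "F holomorphic_on ball 0 1"
    unfolding F_def using holomorphic by (intro holomorphic_intros)
  show "F 0 = 0"
    by (simp add: F_def at_0)
  show "deriv F 0 = 1"
    using D[of 0 1] by (simp add: at_0)
  show "- M < Re (z * deriv (deriv F) z)" if z: "z \<in> ball 0 1" for z
  proof -
    have "cmod (\<epsilon> * (z * deriv (deriv g) z)) \<le> cmod (z * deriv (deriv g) z)"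
      using assms(1) by (simp add: norm_mult mult_left_le_one_le)
    then have "- cmod (z * deriv (deriv g) z) \<le> Re (\<epsilon> * (z * deriv (deriv g) z))"
      using abs_Re_le_cmod[of "\<epsilon> * (z * deriv (deriv g) z)"] by linarith
    moreover have "z * deriv (deriv F) z = z * deriv (deriv h) z + \<epsilon> * (z * deriv (deriv g) z)"
      using D[OF z, of 2] by (simp add: numeral_2_eq_2 algebra_simps)
    ultimately show ?thesis
      using second_deriv[OF z] by (simp only: plus_complex.sel)
  qed
  show "(\<lambda>n. (ca n + \<epsilon> * cb n) * z ^ n) sums F z" if "z \<in> ball 0 1" for z
    using sums_add[OF sums_h_g(1)[OF that] sums_mult[OF sums_h_g(2)[OF that], of \<epsilon>]]
    by (simp add: F_def algebra_simps)
qed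

lemma coeff_sum_bound:
  assumes "2 \<le> n"
  shows "cmod (a n) + cmod (b n) \<le> 2 * M / (real n * (real n - 1))"
proof -
  obtain \<epsilon> where \<epsilon>: "cmod \<epsilon> = 1" "cmod (a n + \<epsilon> * b n) = cmod (a n) + cmod (b n)"
    using exists_aligning_rotation .
  then have "cmod \<epsilon> \<le> 1"
    by simp
  from coeff_bound[OF rotated(5)[OF this] M_pos rotated(4)[OF this] assms]
  show ?thesis
    using assms \<epsilon>(2) by (simp add: ca_def cb_def)
qed

lemma norm_lower:
  assumes z: "cmod z < 1"
  shows "cmod z - 2 * M * ((1 + cmod z) * ln (1 + cmod z) - cmod z) \<le> cmod (f z)"
proof (cases "z = 0")
  case False
  obtain \<epsilon> where \<epsilon>: "cmod \<epsilon> = 1" "\<epsilon> * (g z / z) = of_real (cmod (g z / z))"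
    using exists_rotation_to_norm .
  \<comment> \<open>With the sign reversed, \<open>g\<close> contributes exactly
    \<open>- cmod (g z / z)\<close> to \<open>Re (F z / z)\<close>.\<close>
  then have "cmod (- \<epsilon>) \<le> 1"
    by simp
  from Re_growth_lower[OF rotated(1-3)[OF this] M_pos rotated(4)[OF this] z False]
  have "cmod z - 2 * M * ((1 + cmod z) * ln (1 + cmod z) - cmod z)
      \<le> Re ((h z + - \<epsilon> * g z) / z) * cmod z" .
  also have "(h z + - \<epsilon> * g z) / z = h z / z - of_real (cmod (g z / z))"
    using \<epsilon>(2) by (simp add: diff_divide_distrib)
  also have "Re (h z / z - of_real (cmod (g z / z))) * cmod z \<le> (cmod (h z / z) - cmod (g z / z)) * cmod z"
    using complex_Re_le_cmod[of "h z / z"] by (intro mult_right_mono) auto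
  also have "\<dots> = cmod (h z) - cmod (g z)"
    using False by (simp add: norm_divide field_simps)
  also have "\<dots> \<le> cmod (f z)"
    using norm_diff_ineq[of "h z" "cnj (g z)"] f_eq z by simp
  finally show ?thesis .
qed (use f_eq at_0 in auto)

lemma norm_upper:
  assumes z: "cmod z < 1"
  shows "cmod (f z) \<le> cmod z + 2 * M * log_sum (cmod z)"
proof -
  obtain \<epsilon> where \<epsilon>: "cmod \<epsilon> = 1" "cmod (h z + \<epsilon> * g z) = cmod (h z) + cmod (g z)"
    using exists_aligning_rotation .
  let ?r = "cmod z"
  have "cmod (f z) \<le> cmod (h z) + cmod (g z)"
    using norm_triangle_ineq[of "h z" "cnj (g z)"] f_eq z by simp
  also have "\<dots> \<le> ?r + 2 * M * log_sum ?r"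
    unfolding \<epsilon>(2)[symmetric]
  proof (rule norm_sums_le)
    show "(\<lambda>n. (ca n + \<epsilon> * cb n) * z ^ n) sums (h z + \<epsilon> * g z)"
      using rotated(5)[of \<epsilon> z] \<epsilon>(1) z by simp
    \<comment> \<open>The extra term at index 1 accounts for \<open>ca 1 = 1\<close>; the other
      summand is 0 there by division by zero.\<close>
    show "(\<lambda>n. (if n = 1 then ?r else 0) + 2 * M * (?r ^ n / (real n * (real n - 1))))
        sums (?r + 2 * M * log_sum ?r)"
      using log_sum_sums[of ?r] sums_single[of 1 "\<lambda>_. ?r"] z
      by (intro sums_add sums_mult) auto
    show "cmod ((ca n + \<epsilon> * cb n) * z ^ n)
        \<le> (if n = 1 then ?r else 0) + 2 * M * (?r ^ n / (real n * (real n - 1)))" for n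
    proof (cases "2 \<le> n")
      case True
      have "cmod (a n + \<epsilon> * b n) \<le> cmod (a n) + cmod (b n)"
        using norm_triangle_ineq[of "a n" "\<epsilon> * b n"] \<epsilon>(1) by (simp add: norm_mult)
      also note coeff_sum_bound[OF True]
      finally have "cmod (a n + \<epsilon> * b n) * ?r ^ n \<le> 2 * M / (real n * (real n - 1)) * ?r ^ n"
        by (rule mult_right_mono) simp
      then show ?thesis
        using True by (simp add: ca_def cb_def norm_mult norm_power)
    next
      case False
      then have "n = 0 \<or> n = 1"
        by auto
      then show ?thesis
        by (auto simp: ca_def cb_def)
    qed
  qed
  finally show ?thesis .
qed

lemma tail_upper:
  assumes z: "cmod z < 1" and N: "2 \<le> N"
  shows "(\<Sum>\<^sub>\<infinity>n\<in>{N..}. (cmod (a n) + cmod (b n)) * cmod z ^ n) \<le> 2 * M * log_tail N (cmod z)"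
proof -
  let ?r = "cmod z"
  have "((\<lambda>n. 2 * M * (?r ^ n / (real n * (real n - 1)))) has_sum 2 * M * log_tail N ?r) {N..}"
    using z N by (intro has_sum_cmult_right log_tail_has_sum) auto
  moreover have le: "(cmod (a n) + cmod (b n)) * ?r ^ n \<le> 2 * M * (?r ^ n / (real n * (real n - 1)))"
    if "n \<in> {N..}" for n
    using mult_right_mono[OF coeff_sum_bound[of n], of "?r ^ n"] N that by simp
  moreover from calculation have "(\<lambda>n. (cmod (a n) + cmod (b n)) * ?r ^ n) summable_on {N..}"
    by (intro summable_on_comparison_test[OF has_sum_imp_summable]) auto
  ultimately show ?thesis
    by (metis (no_types, lifting) has_sum_infsum has_sum_mono)
qed

lemma boundary_dist_ge: "ereal (1 - 2 * M * (ln 4 - 1)) \<le> boundary_dist f"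
proof -
  \<comment> \<open>The minorant of \<open>norm_lower\<close> as a function of the modulus; it is
    continuous up to 1, where \<open>2 * ln 2 = ln 4\<close> gives the constant.\<close>
  define G where "G r = r - 2 * M * ((1 + r) * ln (1 + r) - r)" for r :: real
  have "(G \<longlongrightarrow> G 1) (at_left 1)"
    unfolding G_def by (intro tendsto_intros) auto
  moreover have "G 1 = 1 - 2 * M * (ln 4 - 1)"
    using ln_realpow[of 2 2] by (simp add: G_def)
  ultimately have lim: "(G \<longlongrightarrow> 1 - 2 * M * (ln 4 - 1)) (at_left 1)"
    by simp
  show ?thesis
    unfolding boundary_dist_def le_Liminf_iff
  proof (intro allI impI)
    fix y assume y: "y < ereal (1 - 2 * M * (ln 4 - 1))"
    have "((\<lambda>r. ereal (G r)) \<longlongrightarrow> ereal (1 - 2 * M * (ln 4 - 1))) (at_left 1)"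
      using lim by simp
    from order_tendstoD(1)[OF this y] have "\<forall>\<^sub>F r in at_left 1. y < ereal (G r)" .
    moreover have "\<forall>\<^sub>F r in at_left 1. r \<in> {0<..<(1::real)}"
      by (rule eventually_at_left_real) simp
    ultimately have "\<forall>\<^sub>F r in at_left 1. y < ereal (G r) \<and> r < 1"
      by eventually_elim auto
    then have "\<forall>\<^sub>F z in filtercomap cmod (at_left 1). y < ereal (G (cmod z)) \<and> cmod z < 1"
      by (rule eventually_filtercomapI)
    then show "\<forall>\<^sub>F z in filtercomap cmod (at_left 1). y < ereal (cmod (f z - f 0))"
    proof eventually_elim
      case (elim z)
      then have "G (cmod z) \<le> cmod (f z - f 0)"
        using norm_lower[of z] f_eq[of 0] at_0 by (simp add: G_def)
      with elim show ?case
        using less_le_trans ereal_less_eq(3) by blast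
    qed
  qed
qed

end

section \<open>The root of the radius equation and the inequality up to it\<close>

lemma radius_fun_strict_mono:
  assumes "0 < M" "2 \<le> N" "0 \<le> r" "r < s" "s < 1"
  shows "radius_fun M N r < radius_fun M N s"
proof -
  have "log_sum r + log_tail N r \<le> log_sum s + log_tail N s"
    unfolding log_sum_eq_tail using assms by (intro add_mono log_tail_mono) auto
  then have "2 * M * (log_sum r + log_tail N r + (ln 4 - 1)) \<le> 2 * M * (log_sum s + log_tail N s + (ln 4 - 1))"
    using assms by (intro mult_left_mono) auto
  with \<open>r < s\<close> show ?thesis
    unfolding radius_fun_eq by linarith
qed

text \<open>The bound on \<open>M\<close> says that
  \<open>radius_fun M N 0 = 2 * M * (ln 4 - 1) - 1\<close> is negative. The intermediate value
  theorem gives a root, and strict monotonicity makes it the only one.\<close>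

lemma ex_smallest_root:
  assumes M: "0 < M" "M < 1 / (2 * (ln 4 - 1))" and N: "2 \<le> N"
  shows "\<exists>r. is_smallest_root M N r"
proof -
  have ln4: "1 < ln (4 :: real)"
    using e_less_272 ln_less_cancel_iff[of "exp 1" "4 :: real"] by simp
  \<comment> \<open>Here \<open>s - 1\<close> uses up only half of
    \<open>2 * M * (ln 4 - 1)\<close>, so \<open>radius_fun M N s\<close> is positive.\<close>
  define s where "s = 1 - M * (ln 4 - 1)"
  have small: "2 * M * (ln 4 - 1) < 1"
    using M ln4 by (simp add: field_simps)
  have "0 < M * (ln 4 - 1)"
    using M ln4 by simp
  then have s: "0 < s" "s < 1"
    using small by (auto simp: s_def)
  have "continuous_on {0..s} (radius_fun M N)"
    unfolding radius_fun_def using s by (intro continuous_intros) auto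
  moreover have "log_sum 0 = 0" "log_tail N 0 = 0"
    by (auto simp: log_sum_def log_tail_def intro!: sum.neutral)
  then have neg: "radius_fun M N 0 < 0"
    using small by (simp add: radius_fun_eq)
  moreover have pos: "0 < radius_fun M N s"
  proof -
    have "0 \<le> log_sum s + log_tail N s"
      unfolding log_sum_eq_tail using s N by (intro add_nonneg_nonneg log_tail_nonneg) auto
    then have "2 * M * (ln 4 - 1) \<le> 2 * M * (log_sum s + log_tail N s + (ln 4 - 1))"
      using M by (intro mult_left_mono) auto
    moreover have "s - 1 = - (M * (ln 4 - 1))"
      by (simp add: s_def)
    ultimately show ?thesis
      unfolding radius_fun_eq using \<open>0 < M * (ln 4 - 1)\<close> by linarith
  qed
  ultimately obtain r where r: "0 \<le> r" "r \<le> s" "radius_fun M N r = 0"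
    using IVT'[of "radius_fun M N" 0 0 s] s by auto
  moreover have "r \<noteq> 0"
    using r neg by auto
  moreover have "r \<le> q" if "0 < q" "q < 1" "radius_fun M N q = 0" for q
    using radius_fun_strict_mono[OF M(1) N, of q r] that r s by fastforce
  ultimately have "is_smallest_root M N r"
    using s by (auto simp: is_smallest_root_def)
  then show ?thesis ..
qed

lemma bohr_rogosinski_ineq_if:
  assumes "0 < M" "2 \<le> N" and root: "is_smallest_root M N R"
    and f: "f \<in> class_P0H M" "has_harmonic_expansion f a b" and z: "cmod z \<le> R"
  shows "bohr_rogosinski_ineq N f a b z"
proof -
  obtain h g where "H0_decomposition f h g"
    "\<forall>z\<in>ball 0 1. - M + cmod (z * deriv (deriv g) z) < Re (z * deriv (deriv h) z)"
    using f(1) unfolding class_P0H_def by blast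
  then interpret P0H_member M f h g a b
    using f(2) \<open>0 < M\<close> by unfold_locales blast+
  have R: "0 < R" "R < 1" "radius_fun M N R = 0"
    using root by (auto simp: is_smallest_root_def)
  have z1: "cmod z < 1"
    using z R by simp
  have "radius_fun M N (cmod z) \<le> 0"
    using radius_fun_strict_mono[OF assms(1,2), of "cmod z" R] z R by (cases "cmod z = R") auto
  then have "cmod z + 2 * M * log_sum (cmod z) + 2 * M * log_tail N (cmod z) \<le> 1 - 2 * M * (ln 4 - 1)"
    by (simp add: radius_fun_eq algebra_simps)
  then have "cmod (f z) + (\<Sum>\<^sub>\<infinity>n\<in>{N..}. (cmod (a n) + cmod (b n)) * cmod z ^ n) \<le> 1 - 2 * M * (ln 4 - 1)"
    using norm_upper[OF z1] tail_upper[OF z1 \<open>2 \<le> N\<close>] by linarith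
  then show ?thesis
    unfolding bohr_rogosinski_ineq_def using boundary_dist_ge order_trans ereal_less_eq(3) by blast
qed

section \<open>The extremal mapping\<close>

definition extremal :: "real \<Rightarrow> complex \<Rightarrow> complex" where
  "extremal M z = z + of_real (2 * M) * (z + (1 - z) * Ln (1 - z))"

lemma one_minus_notin_nonpos_Reals:
  assumes "cmod z < 1"
  shows "1 - z \<notin> \<real>\<^sub>\<le>\<^sub>0"
  using assms complex_Re_le_cmod[of z] by (auto simp: complex_nonpos_Reals_iff)

text \<open>Here \<open>g = 0\<close> and \<open>z h'' + M = M (1 + z) / (1 - z)\<close>, a multiple
  of the half-plane map, which is extremal for both Caratheodory and Harnack.\<close>

lemma extremal_in_class:
  assumes "0 < M"
  shows "extremal M \<in> class_P0H M"
proof -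
  let ?h = "extremal M" and ?g = "\<lambda>_. 0 :: complex"
  have dh: "(?h has_field_derivative 1 - of_real (2 * M) * Ln (1 - z)) (at z)" if "z \<in> ball 0 1" for z
  proof -
    have "1 - z \<notin> \<real>\<^sub>\<le>\<^sub>0" "1 - z \<noteq> 0"
      using one_minus_notin_nonpos_Reals[of z] that by auto
    \<comment> \<open>The shape in which \<open>derivative_eq_intros\<close> leaves the derivative
      of the logarithm times \<open>1 - z\<close>.\<close>
    moreover have "inverse w * (0 - 1) * w = - 1" if "w \<noteq> 0" for w :: complex
      using that by simp
    note this[OF \<open>1 - z \<noteq> 0\<close>]
    ultimately show ?thesis
      unfolding extremal_def
      by - ((rule derivative_eq_intros refl | assumption)+, simp only:, simp)
  qed
  have d: "deriv ?h z = 1 - of_real (2 * M) * Ln (1 - z)" if "z \<in> ball 0 1" for z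
    using dh[OF that] by (rule DERIV_imp_deriv)
  have dd: "deriv (deriv ?h) z = of_real (2 * M) / (1 - z)" if "z \<in> ball 0 1" for z
  proof (rule DERIV_imp_deriv, rule has_field_derivative_transform_within_open)
    show "((\<lambda>z. 1 - of_real (2 * M) * Ln (1 - z)) has_field_derivative of_real (2 * M) / (1 - z)) (at z)"
      using one_minus_notin_nonpos_Reals[of z] that by (auto intro!: derivative_eq_intros simp: divide_inverse)
    show "1 - of_real (2 * M) * Ln (1 - w) = deriv ?h w" if "w \<in> ball 0 1" for w
      using d[OF that] by simp
  qed (use that in auto)
  have "H0_decomposition ?h ?h ?g"
  proof -
    have "?h holomorphic_on ball 0 1"
      using dh by (meson holomorphic_on_open open_ball)
    moreover have "?h 0 = 0" "deriv ?h 0 = 1"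
      using d[of 0] by (simp_all add: extremal_def)
    ultimately show ?thesis
      by (simp add: H0_decomposition_def)
  qed
  moreover have "- M + cmod (z * deriv (deriv ?g) z) < Re (z * deriv (deriv ?h) z)" if z: "z \<in> ball 0 1" for z
  proof -
    have nz: "1 - z \<noteq> 0"
      using z by auto
    have "z * deriv (deriv ?h) z + of_real M = of_real M * ((1 + z) / (1 - z))"
      using nz by (simp add: dd[OF z] field_simps)
    moreover have "Re (of_real M * w) = M * Re w" for w
      by simp
    ultimately have "Re (z * deriv (deriv ?h) z) + M = M * Re ((1 + z) / (1 - z))"
      by (metis Re_complex_of_real plus_complex.sel(1))
    moreover have "0 < Re ((1 + z) / (1 - z))"
    proof -
      have "(cmod z)\<^sup>2 < 1"
        using z abs_square_less_1[of "cmod z"] by simp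
      then have "(Re z)\<^sup>2 + (Im z)\<^sup>2 < 1"
        by (simp add: cmod_power2)
      moreover have "0 < (1 - Re z)\<^sup>2 + (Im z)\<^sup>2"
        using nz by (subst sum_power2_gt_zero_iff) (auto simp: complex_eq_iff)
      moreover have "Re ((1 + z) / (1 - z)) =
          (1 - ((Re z)\<^sup>2 + (Im z)\<^sup>2)) / ((1 - Re z)\<^sup>2 + (Im z)\<^sup>2)"
        by (simp add: Re_divide power2_eq_square algebra_simps)
      ultimately show ?thesis
        by simp
    qed
    ultimately have "0 < Re (z * deriv (deriv ?h) z) + M"
      using \<open>0 < M\<close> by simp
    then show ?thesis
      by (simp del: times_complex.sel)
  qed
  ultimately show ?thesis
    unfolding class_P0H_def class_H0_def mem_Collect_eq by blast
qed

lemma extremal_expansion: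
  "has_harmonic_expansion (extremal M) (\<lambda>n. of_real (2 * M / (real n * (real n - 1)))) (\<lambda>_. 0)"
proof -
  let ?a = "\<lambda>n. of_real (2 * M / (real n * (real n - 1))) :: complex"
  have "(\<lambda>n. ?a (n + 2) * z ^ (n + 2)) sums (of_real (2 * M) * (z + (1 - z) * Ln (1 - z)))"
    if "cmod z < 1" for z
  proof -
    have "(\<lambda>n. ?a n * z ^ n) sums (of_real (2 * M) * (z + (1 - z) * Ln (1 - z)))"
      using sums_mult[OF sums_log_complex[OF that], of "of_real (2 * M)"] by (simp add: mult.assoc)
    then show ?thesis
      \<comment> \<open>The two terms removed by the shift are 0, again because
        \<open>x / 0 = 0\<close>.\<close>
      by (subst sums_iff_shift[of "\<lambda>n. ?a n * z ^ n"]) (simp add: numeral_2_eq_2)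
  qed
  then show ?thesis
    by (auto simp: has_harmonic_expansion_def extremal_def sums_iff)
qed

lemma extremal_of_real:
  assumes "\<bar>x\<bar> < 1"
  shows "extremal M (of_real x) = of_real (x + 2 * M * log_sum x)"
  using assms Ln_of_real[of "1 - x"] by (simp add: extremal_def log_sum_def)

text \<open>At \<open>r\<close> the left side equals its upper bound; along the negative radius the
  modulus tends to \<open>1 - 2 * M * (ln 4 - 1)\<close>, which caps the lower limit.\<close>

lemma not_bohr_rogosinski_extremal:
  assumes M: "0 < M" "2 * M * (ln 4 - 1) \<le> 1" and N: "2 \<le> N" and r: "0 < r" "r < 1"
    and pos: "0 < radius_fun M N r"
  shows "\<not> bohr_rogosinski_ineq N (extremal M) (\<lambda>n. of_real (2 * M / (real n * (real n - 1)))) (\<lambda>_. 0) (of_real r)"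
proof
  let ?a = "\<lambda>n. of_real (2 * M / (real n * (real n - 1))) :: complex"
  assume "bohr_rogosinski_ineq N (extremal M) ?a (\<lambda>_. 0) (of_real r)"
  moreover have "cmod (extremal M (of_real r)) = r + 2 * M * log_sum r"
    using r M log_tail_nonneg[of r 2] by (simp only: extremal_of_real norm_of_real) (simp add: log_sum_eq_tail extremal_of_real)
  moreover have "(\<Sum>\<^sub>\<infinity>n\<in>{N..}. (cmod (?a n) + cmod 0) * cmod (of_real r) ^ n) = 2 * M * log_tail N r"
  proof (rule infsumI)
    have "((\<lambda>n. 2 * M * (r ^ n / (real n * (real n - 1)))) has_sum 2 * M * log_tail N r) {N..}"
      using r N by (intro has_sum_cmult_right log_tail_has_sum) auto
    moreover have "2 * M * (r ^ n / (real n * (real n - 1))) = (cmod (?a n) + cmod 0) * cmod (of_real r) ^ n"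
      if "n \<in> {N..}" for n
      using that N M r by (simp only: norm_of_real) simp
    ultimately show "((\<lambda>n. (cmod (?a n) + cmod 0) * cmod (of_real r) ^ n) has_sum 2 * M * log_tail N r) {N..}"
      by (rule iffD1[OF has_sum_cong, rotated 1])
  qed
  ultimately have le: "ereal (r + 2 * M * log_sum r + 2 * M * log_tail N r) \<le> boundary_dist (extremal M)"
    by (simp add: bohr_rogosinski_ineq_def)
  define c where "c = 1 - 2 * M * (ln 4 - 1)"
  have "c < r + 2 * M * log_sum r + 2 * M * log_tail N r"
    using pos by (simp add: radius_fun_eq c_def algebra_simps)
  \<comment> \<open>\<open>Liminf\<close> gives eventual bounds only for strictly smaller values,
    hence an intermediate \<open>y\<close>.\<close>
  then obtain y where y: "c < y" "y < r + 2 * M * log_sum r + 2 * M * log_tail N r"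
    using dense by blast
  then have "ereal y < boundary_dist (extremal M)"
    using le by (metis ereal_less_eq(3) less_le_trans less_ereal.simps(1))
  then have "\<forall>\<^sub>F z in filtercomap cmod (at_left 1). ereal y < ereal (cmod (extremal M z - extremal M 0))"
    unfolding boundary_dist_def using less_LiminfD by blast
  then obtain P where P: "\<forall>\<^sub>F t in at_left 1. P t"
    "\<And>z. P (cmod z) \<Longrightarrow> y < cmod (extremal M z - extremal M 0)"
    by (auto simp: eventually_filtercomap)
  define G where "G t = \<bar>- t + 2 * M * (- t + (1 + t) * ln (1 + t))\<bar>" for t
  have G: "cmod (extremal M (of_real (- t)) - extremal M 0) = G t" if "0 < t" "t < 1" for t
  proof -
    have "extremal M (of_real (- t)) = of_real (- t + 2 * M * log_sum (- t))" "extremal M 0 = 0"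
      using that by (intro extremal_of_real, simp) (simp add: extremal_def)
    then show ?thesis
      by (simp only: diff_zero norm_of_real) (simp add: G_def log_sum_def)
  qed
  have "\<forall>\<^sub>F t in at_left 1. y \<le> G t"
    using P(1) eventually_at_left_real[of 0 "1::real", OF zero_less_one]
  proof eventually_elim
    case (elim t)
    then show ?case
      using P(2)[of "of_real (- t)"] G[of t] by simp
  qed
  moreover have "(G \<longlongrightarrow> G 1) (at_left 1)"
    unfolding G_def by (intro tendsto_intros) auto
  ultimately have "y \<le> G 1"
    by (intro tendsto_lowerbound) auto
  \<comment> \<open>At 1 the expression inside the absolute value is \<open>- c\<close>, and
    \<open>2 * M * (ln 4 - 1) \<le> 1\<close> makes \<open>c\<close> nonnegative.\<close>
  moreover have "G 1 = c"
    using ln_realpow[of 2 2] M by (simp add: G_def c_def algebra_simps abs_if)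
  ultimately show False
    using y by simp
qed

text \<open>For larger \<open>M\<close>, \<open>radius_fun M N\<close> is nonnegative at 0 and
  strictly increasing, so it has no root in (0, 1); existence is therefore claimed conditionally. In
  the last clause \<open>z \<in> ball 0 1\<close> keeps test points in the disc even if
  \<open>\<rho> \<ge> 1\<close>.\<close>

theorem theorem2p1:
  fixes M :: real and N :: nat
  assumes "M > 0" and "N \<ge> 2"
  shows "(M < 1 / (2 * (ln 4 - 1)) \<longrightarrow> (\<exists>r\<^sub>N. is_smallest_root M N r\<^sub>N)) \<and>
    (\<forall>r\<^sub>N. is_smallest_root M N r\<^sub>N \<longrightarrow>
      (\<forall>f a b z. f \<in> class_P0H M \<and> has_harmonic_expansion f a b \<and> cmod z \<le> r\<^sub>N \<longrightarrow>
         bohr_rogosinski_ineq N f a b z) \<and>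
      (\<forall>\<rho> > r\<^sub>N. \<not> (\<forall>f a b z. f \<in> class_P0H M \<and> has_harmonic_expansion f a b \<and>
         z \<in> ball 0 1 \<and> cmod z \<le> \<rho> \<longrightarrow> bohr_rogosinski_ineq N f a b z)))"
proof (intro conjI allI impI)
  show "\<exists>r. is_smallest_root M N r" if "M < 1 / (2 * (ln 4 - 1))"
    using ex_smallest_root assms that by blast
next
  fix R f a b z
  assume "is_smallest_root M N R" "f \<in> class_P0H M \<and> has_harmonic_expansion f a b \<and> cmod z \<le> R"
  then show "bohr_rogosinski_ineq N f a b z"
    using bohr_rogosinski_ineq_if assms by blast
next
  fix R \<rho> assume root: "is_smallest_root M N R" and "R < \<rho>"
  have R: "0 < R" "R < 1" "radius_fun M N R = 0"
    using root by (auto simp: is_smallest_root_def)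
  obtain r where r: "R < r" "r < min \<rho> 1"
    using dense[of R "min \<rho> 1"] R \<open>R < \<rho>\<close> by auto
  \<comment> \<open>The mere existence of a root \<open>R\<close> forces
    \<open>2 * M * (ln 4 - 1) \<le> 1 - R\<close>, hence the bound on \<open>M\<close> required for
    the extremal mapping.\<close>
  have "0 \<le> log_sum R + log_tail N R"
    unfolding log_sum_eq_tail using R assms by (intro add_nonneg_nonneg log_tail_nonneg) auto
  then have "2 * M * (ln 4 - 1) \<le> 2 * M * (log_sum R + log_tail N R + (ln 4 - 1))"
    using assms by (intro mult_left_mono) auto
  then have "2 * M * (ln 4 - 1) \<le> 1"
    using R unfolding radius_fun_eq by linarith
  moreover have "0 < radius_fun M N r"
    using radius_fun_strict_mono[of M N R r] assms R r by simp
  ultimately have "\<not> bohr_rogosinski_ineq N (extremal M)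
      (\<lambda>n. of_real (2 * M / (real n * (real n - 1)))) (\<lambda>_. 0) (of_real r)"
    using assms R r by (intro not_bohr_rogosinski_extremal) auto
  moreover have "complex_of_real r \<in> ball 0 1" "cmod (of_real r) \<le> \<rho>"
    using R r by auto
  ultimately show "\<not> (\<forall>f a b z. f \<in> class_P0H M \<and> has_harmonic_expansion f a b \<and>
      z \<in> ball 0 1 \<and> cmod z \<le> \<rho> \<longrightarrow> bohr_rogosinski_ineq N f a b z)"
    using extremal_in_class[OF \<open>M > 0\<close>] extremal_expansion by blast
qed

end
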